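(* Let $n>5$ be a prime power congruent to $1$ modulo $4$, and let $GF(n)$ be the finite field of order $n$. Let $x,y\in GF(n)$ be such that $x-y$ is a non-zero square in $GF(n)$. Then for any subset $S\subset GF(n)\setminus\{x,y\}$ with $|S|\geq\frac{3}{4}(n-1)$, there exist $w,z\in S$ such that $x-w$, $w-z$, $z-y$ are non-zero squares in $GF(n)$ and $x-z$, $y-w$ are not squares in $GF(n)$. *)

theory Defs
  imports
    Complex_Main
    "HOL-Computational_Algebra.Nth_Powers"
    "HOL-Number_Theory.Number_Theory"
    "HOL-Library.Cardinality"
begin

end

theory Submission
  imports Defs
begin

text \<open>
  Join two field elements when their difference is a nonzero square. Since \<open>n = 4 m + 1\<close>, this is a
  graph, and its signed adjacency matrix \<open>M\<close> (\<open>1\<close> for joined, \<open>-1\<close> for distinct and not joined,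
  \<open>0\<close> on the diagonal) has vanishing row sums and pairwise row products \<open>-1\<close>; these identities
  are all that is used about the field. They split the points other than \<open>x\<close> and \<open>y\<close> into the
  points \<open>A\<close> joined to \<open>x\<close> only, \<open>B\<close> joined to \<open>y\<close> only, \<open>C\<close> joined to neither and \<open>D\<close> joined
  to both, of sizes \<open>m\<close>, \<open>m\<close>, \<open>m\<close> and \<open>m - 1\<close>. The wanted points are joined points
  \<open>w \<in> A \<inter> S\<close> and \<open>z \<in> B \<inter> S\<close>. As \<open>S\<close> misses at most \<open>m - 1\<close> points apart from
  \<open>x\<close> and \<open>y\<close>, we have \<open>|A \<inter> S| + |B \<inter> S| \<ge> m + 1\<close>. Hence it suffices that sets
  \<open>X \<subseteq> A\<close> and \<open>Z \<subseteq> B\<close> without an edge between them satisfy \<open>|X| + |Z| \<le> m\<close>; by Koenig's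
  theorem this amounts to a perfect matching between \<open>A\<close> and \<open>B\<close>, but the matching itself never
  has to be constructed.

  For this bound (\<open>unjoined_sets_card\<close>) consider the vector \<open>h = M 1\<^sub>Z\<close>, with \<open>s = |X|\<close> and
  \<open>t = |Z|\<close>. Its squared norm is \<open>n t - t\<^sup>2\<close>. It equals \<open>-t\<close> on \<open>X\<close>, which already
  costs \<open>s t\<^sup>2\<close>, and the row identities force its values on \<open>(A - X) \<union> C\<close> to sum to
  \<open>s t\<close>, which costs more. Real estimates fall just short in the smallest cases, but \<open>h\<close> has
  integer entries of known parity: off \<open>Z\<close> they are congruent to \<open>t\<close> modulo 2, on \<open>Z\<close> to
  \<open>t - 1\<close>. Using that, \<open>s + t > m\<close> is contradictory if \<open>t\<close> is even, and also if \<open>t\<close> is odd and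
  \<open>s, t \<ge> 2\<close>. By the symmetry between \<open>x\<close> and \<open>y\<close> there remains the case that \<open>X\<close> is a
  single point and \<open>Z = B\<close> has odd size; then the row of \<open>M\<close> at that point is completely
  determined, and comparing it with the row of a common neighbour of \<open>x\<close> and \<open>y\<close> shows that
  \<open>m\<close> is even (\<open>joined_to_opposite_block\<close>).
\<close>

section \<open>Parity counts\<close>

lemma even_card_fixpoint_free_involution:
  assumes "finite A" "\<And>a. a \<in> A \<Longrightarrow> f a \<in> A" "\<And>a. a \<in> A \<Longrightarrow> f (f a) = a"
    and "\<And>a. a \<in> A \<Longrightarrow> f a \<noteq> a"
  shows "even (card A)"
  using assms
proof (induction A rule: finite_psubset_induct)
  case (psubset A)
  show ?case
  proof (cases "A = {}")
    case False
    then obtain a where a: "a \<in> A" by blast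
    let ?A = "A - {a, f a}"
    have "even (card ?A)"
    proof (rule psubset.IH)
      show "?A \<subset> A" using a by blast
      show "f b \<in> ?A" if "b \<in> ?A" for b
        using that psubset.prems(1,2) a by (metis Diff_iff insert_iff singletonD)
    qed (use psubset.prems in auto)
    moreover have "card A = card ?A + 2"
    proof -
      have "card ?A = card A - card {a, f a}"
        using a psubset.prems(1) by (intro card_Diff_subset) auto
      moreover have "card {a, f a} \<le> card A"
        using a psubset.prems(1) psubset.hyps by (intro card_mono) auto
      moreover have "card {a, f a} = 2" using psubset.prems(3)[OF a] by simp
      ultimately show ?thesis by linarith
    qed
    ultimately show ?thesis by simp
  qed simp
qed

lemma sum_signs_parity:
  fixes f :: "'b \<Rightarrow> int"
  assumes "finite T" "\<And>u. u \<in> T \<Longrightarrow> f u = 1 \<or> f u = -1"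
  shows "even (sum f T) \<longleftrightarrow> even (card T)"
  using assms
proof (induction T rule: finite_induct)
  case (insert u T)
  then have "odd (f u)" by (metis even_minus insertI1 odd_one)
  with insert show ?case by simp
qed simp

section \<open>Conference graphs\<close>

text \<open>
  The matrix \<open>M\<close> is \<open>2 Adj - J + I\<close> for the adjacency matrix \<open>Adj\<close> of a strongly regular graph with
  parameters \<open>(4 m + 1, 2 m, m - 1, m)\<close>. The signed form is preferred because the parameters then
  become the relations \<open>M J = 0\<close> and \<open>M\<^sup>2 = n I - J\<close> with \<open>n = 4 m + 1\<close>.
\<close>

locale conference_graph =
  fixes M :: "'a::finite \<Rightarrow> 'a \<Rightarrow> int" and m :: nat
  assumes sym: "M u v = M v u"
    and diag: "M u u = 0"
    and off_diag: "u \<noteq> v \<Longrightarrow> M u v = 1 \<or> M u v = -1"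
    and row_sum: "(\<Sum>v\<in>UNIV. M u v) = 0"
    and row_inner: "u \<noteq> v \<Longrightarrow> (\<Sum>w\<in>UNIV. M u w * M v w) = -1"
    and card_points: "CARD('a) = 4 * m + 1"
begin

definition block :: "'a \<Rightarrow> 'a \<Rightarrow> int \<Rightarrow> int \<Rightarrow> 'a set"
  where "block x y i j = {u. M x u = i \<and> M y u = j}"

lemma block_swap: "block y x i j = block x y j i"
  by (auto simp: block_def)

lemma row_norm: "(\<Sum>w\<in>UNIV. M u w * M u w) = 4 * int m"
proof -
  have "(\<Sum>w\<in>UNIV. M u w * M u w) = (\<Sum>w\<in>UNIV. if w = u then 0 else 1)"
    using off_diag[of u] by (intro sum.cong) (auto simp: diag, force)
  also have "\<dots> = (\<Sum>w\<in>UNIV - {u}. 1)"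
    by (rule sum.mono_neutral_cong_right) auto
  finally show ?thesis by (simp add: card_points)
qed

lemma sum_blocks:
  fixes f :: "'a \<Rightarrow> int"
  assumes "x \<noteq> y"
  shows "sum f UNIV = f x + f y + sum f (block x y 1 (-1)) + sum f (block x y (-1) 1)
           + sum f (block x y (-1) (-1)) + sum f (block x y 1 1)"
proof -
  have U: "UNIV = insert x (insert y (block x y 1 (-1) \<union> block x y (-1) 1
             \<union> block x y (-1) (-1) \<union> block x y 1 1))"
    using off_diag by (auto simp: block_def, metis+)
  show ?thesis
    by (subst U, (subst sum.insert sum.union_disjoint;
        (use assms in \<open>auto simp: block_def diag\<close>)?)+)
qed

text \<open>
  Together with \<open>sum_blocks\<close>, this turns any information on the products of a vector with \<open>1\<close> and
  with the rows at \<open>x\<close> and \<open>y\<close> into three linear equations between its four block sums.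
\<close>

lemma row_products:
  fixes f :: "'a \<Rightarrow> int"
  assumes "M x y = 1"
  shows "(\<Sum>u\<in>UNIV. M x u * f u) = f y + sum f (block x y 1 (-1)) - sum f (block x y (-1) 1)
           - sum f (block x y (-1) (-1)) + sum f (block x y 1 1)" (is ?X)
    and "(\<Sum>u\<in>UNIV. M y u * f u) = f x - sum f (block x y 1 (-1)) + sum f (block x y (-1) 1)
           - sum f (block x y (-1) (-1)) + sum f (block x y 1 1)" (is ?Y)
proof -
  have xy: "x \<noteq> y" using assms diag by force
  have yx: "M y x = 1" using assms sym by simp
  have "(\<Sum>u\<in>block x y i j. M x u * f u) = i * sum f (block x y i j)"
       "(\<Sum>u\<in>block x y i j. M y u * f u) = j * sum f (block x y i j)" for i j
    by (auto simp: sum_distrib_left block_def intro!: sum.cong)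
  then show ?X ?Y
    using assms yx by (simp_all add: sum_blocks[OF xy] diag)
qed

lemma card_blocks:
  assumes "M x y = 1"
  shows "card (block x y 1 (-1)) = m" "card (block x y (-1) 1) = m"
    "card (block x y (-1) (-1)) = m" "int (card (block x y 1 1)) = int m - 1"
proof -
  have xy: "x \<noteq> y" using assms diag by force
  note * = row_products[OF assms, of "\<lambda>_. 1"] sum_blocks[OF xy, of "\<lambda>_. 1"]
  have "(\<Sum>u\<in>block x y i j. M y u) = j * int (card (block x y i j))" for i j
    by (simp add: block_def)
  with row_products(1)[OF assms, of "M y"] row_inner[OF xy]
  show "card (block x y 1 (-1)) = m" "card (block x y (-1) 1) = m"
    "card (block x y (-1) (-1)) = m" "int (card (block x y 1 1)) = int m - 1"
    using * by (simp_all add: row_sum card_points diag)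
qed

definition signed_degree :: "'a set \<Rightarrow> 'a \<Rightarrow> int"
  where "signed_degree Z u = (\<Sum>z\<in>Z. M u z)"

text \<open>
  The signed degree is the vector \<open>M 1\<^sub>Z\<close>, so all three are read off from \<open>M J = 0\<close> and
  \<open>M\<^sup>2 = n I - J\<close>.
\<close>

lemma signed_degree_sums:
  fixes Z :: "'a set"
  defines "h \<equiv> signed_degree Z"
  shows "sum h UNIV = 0" and "(\<Sum>u\<in>UNIV. h u * h u) = (4 * int m + 1) * card Z - (int (card Z))^2"
    and "x \<notin> Z \<Longrightarrow> (\<Sum>u\<in>UNIV. M x u * h u) = - int (card Z)"
proof -
  have "sum h UNIV = (\<Sum>z\<in>Z. \<Sum>u\<in>UNIV. M z u)"
    unfolding h_def signed_degree_def by (subst sum.swap) (simp add: sym)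
  then show "sum h UNIV = 0" by (simp add: row_sum)
  have inner: "(\<Sum>u\<in>UNIV. M x u * h u) = (\<Sum>z\<in>Z. \<Sum>u\<in>UNIV. M x u * M z u)" for x
    unfolding h_def signed_degree_def sum_distrib_left by (subst sum.swap) (simp add: sym)
  show "(\<Sum>u\<in>UNIV. M x u * h u) = - int (card Z)" if "x \<notin> Z"
  proof -
    have "(\<Sum>u\<in>UNIV. M x u * M z u) = -1" if "z \<in> Z" for z
      using row_inner[of x z] that \<open>x \<notin> Z\<close> by blast
    then show ?thesis by (simp add: inner)
  qed
  have inZ: "(\<Sum>u\<in>UNIV. M x u * h u) = (4 * int m + 1) - int (card Z)" if "x \<in> Z" for x
  proof -
    have "(\<Sum>z\<in>Z. \<Sum>u\<in>UNIV. M x u * M z u)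
        = (\<Sum>u\<in>UNIV. M x u * M x u) + (\<Sum>z\<in>Z - {x}. \<Sum>u\<in>UNIV. M x u * M z u)"
      using that by (intro sum.remove) auto
    also have "(\<Sum>z\<in>Z - {x}. \<Sum>u\<in>UNIV. M x u * M z u) = (\<Sum>z\<in>Z - {x}. -1)"
      using row_inner[of x] by (intro sum.cong) auto
    finally show ?thesis
      using that card_gt_0_iff[of Z] by (auto simp: inner row_norm of_nat_diff)
  qed
  have "(\<Sum>u\<in>UNIV. h u * h u) = (\<Sum>u\<in>UNIV. \<Sum>z\<in>Z. M z u * h u)"
    by (rule sum.cong[OF refl], subst (1) h_def, subst signed_degree_def) (simp add: sum_distrib_right sym)
  also have "\<dots> = (\<Sum>z\<in>Z. \<Sum>u\<in>UNIV. M z u * h u)"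
    by (rule sum.swap)
  also have "\<dots> = int (card Z) * ((4 * int m + 1) - int (card Z))"
    by (simp add: inZ)
  finally show "(\<Sum>u\<in>UNIV. h u * h u) = (4 * int m + 1) * card Z - (int (card Z))^2"
    by (simp add: algebra_simps power2_eq_square)
qed

lemma signed_degree_parity:
  shows "z \<notin> Z \<Longrightarrow> even (signed_degree Z z) \<longleftrightarrow> even (card Z)"
    and "z \<in> Z \<Longrightarrow> even (signed_degree Z z) \<longleftrightarrow> odd (card Z)"
proof -
  show "even (signed_degree Z z) \<longleftrightarrow> even (card Z)" if "z \<notin> Z"
    using that off_diag unfolding signed_degree_def
    by (intro sum_signs_parity) (simp, metis)
  show "even (signed_degree Z z) \<longleftrightarrow> odd (card Z)" if "z \<in> Z"
  proof -
    have "(\<Sum>v\<in>Z. M z v) = (\<Sum>v\<in>Z - {z}. M z v)"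
      using that by (subst sum.remove[of Z z]) (simp_all add: diag)
    moreover have "even (\<Sum>v\<in>Z - {z}. M z v) \<longleftrightarrow> even (card (Z - {z}))"
      using off_diag by (intro sum_signs_parity) (simp, metis Diff_iff singletonI)
    moreover have "card Z = Suc (card (Z - {z}))"
      using that by (intro card.remove) auto
    ultimately show ?thesis by (simp add: signed_degree_def)
  qed
qed

text \<open>
  The signed degree is \<open>-t\<close> on \<open>X\<close> and at \<open>x\<close>, and \<open>t\<close> at \<open>y\<close>, so its norm distributes over
  these points and the three sets \<open>P\<close>, \<open>Q\<close>, \<open>Z\<close>. The three linear equations for the block sums say
  in particular that the blocks joined to \<open>x\<close> only and to neither point have opposite sums;
  removing \<open>X\<close> from them leaves \<open>s t\<close> on \<open>P\<close>. Everything later is a lower bound for the three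
  remaining sums of squares.
\<close>

lemma unjoined_sets_profile:
  assumes xy: "M x y = 1"
    and X: "X \<subseteq> block x y 1 (-1)" and Z: "Z \<subseteq> block x y (-1) 1"
    and unjoined: "\<And>u v. u \<in> X \<Longrightarrow> v \<in> Z \<Longrightarrow> M u v = -1"
  defines "h \<equiv> signed_degree Z" and "P \<equiv> (block x y 1 (-1) - X) \<union> block x y (-1) (-1)"
    and "Q \<equiv> (block x y (-1) 1 - Z) \<union> block x y 1 1"
    and "s \<equiv> int (card X)" and "t \<equiv> int (card Z)"
  shows "sum h P = s * t"
    and "(4 * int m + 1) * t - t^2 = 2 * t^2 + s * t^2 + (\<Sum>u\<in>P. h u * h u) + (\<Sum>u\<in>Q. h u * h u)
           + (\<Sum>u\<in>Z. h u * h u)"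
    and "int (card P) = 2 * int m - s" and "int (card Q) = 2 * int m - 1 - t"
    and "P \<inter> Z = {}" and "Q \<inter> Z = {}"
proof -
  have ne: "x \<noteq> y" using xy diag by force
  have yx: "M y x = 1" using xy sym by simp
  let ?A = "block x y 1 (-1)" and ?B = "block x y (-1) 1"
  let ?C = "block x y (-1) (-1)" and ?D = "block x y 1 1"
  have nin: "x \<notin> Z" "y \<notin> Z" using Z xy yx by (auto simp: block_def diag)
  have hX: "h u = - t" if "u \<in> X" for u
    using unjoined[OF that] by (simp add: h_def signed_degree_def t_def)
  have hxy: "h x = - t" "h y = t"
  proof -
    have "M x z = -1" "M y z = 1" if "z \<in> Z" for z using that Z by (auto simp: block_def)
    then show "h x = - t" "h y = t" by (simp_all add: h_def signed_degree_def t_def)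
  qed
  have split: "sum f P = sum f ?A - sum f X + sum f ?C"
      "sum f Q = sum f ?B - sum f Z + sum f ?D" for f :: "'a \<Rightarrow> int"
  proof -
    have "sum f P = sum f (?A - X) + sum f ?C"
      unfolding P_def by (rule sum.union_disjoint) (auto simp: block_def)
    then show "sum f P = sum f ?A - sum f X + sum f ?C" using X by (simp add: sum_diff)
    have "sum f Q = sum f (?B - Z) + sum f ?D"
      unfolding Q_def by (rule sum.union_disjoint) (auto simp: block_def)
    then show "sum f Q = sum f ?B - sum f Z + sum f ?D" using Z by (simp add: sum_diff)
  qed
  have "(\<Sum>u\<in>UNIV. M x u * h u) = - t" "(\<Sum>u\<in>UNIV. M y u * h u) = - t"
    using signed_degree_sums(3) nin by (simp_all add: h_def t_def)
  then have "sum h ?A + sum h ?C = 0"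
    using row_products[OF xy, of h] sum_blocks[OF ne, of h] hxy
      signed_degree_sums(1)[of Z, folded h_def] by simp
  then show "sum h P = s * t" using split(1)[of h] hX by (simp add: s_def)
  have "(\<Sum>u\<in>X. h u * h u) = s * t^2" using hX by (simp add: s_def power2_eq_square)
  moreover have "(\<Sum>u\<in>UNIV. h u * h u) = (4 * int m + 1) * t - t^2"
    using signed_degree_sums(2)[of Z] by (simp add: h_def signed_degree_def t_def)
  ultimately show "(4 * int m + 1) * t - t^2 = 2 * t^2 + s * t^2 + (\<Sum>u\<in>P. h u * h u)
      + (\<Sum>u\<in>Q. h u * h u) + (\<Sum>u\<in>Z. h u * h u)"
    using hxy sum_blocks[OF ne, of "\<lambda>u. h u * h u"] split[of "\<lambda>u. h u * h u"]
    by (simp add: power2_eq_square)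
  show "int (card P) = 2 * int m - s" "int (card Q) = 2 * int m - 1 - t"
    using split[of "\<lambda>_. 1"] card_blocks[OF xy] by (simp_all add: s_def t_def)
  show "P \<inter> Z = {}" "Q \<inter> Z = {}" using Z by (auto simp: P_def Q_def block_def)
qed

text \<open>
  For even \<open>|Z|\<close>, the entries on \<open>P\<close> are even, so \<open>h\<^sup>2 \<ge> 2 h\<close> there and their squares
  contribute at least \<open>2 s t\<close>, while the entries on \<open>Z\<close> are odd and contribute at least \<open>t\<close>.
\<close>

lemma unjoined_sets_card_even:
  assumes xy: "M x y = 1"
    and X: "X \<subseteq> block x y 1 (-1)" and Z: "Z \<subseteq> block x y (-1) 1"
    and unjoined: "\<And>u v. u \<in> X \<Longrightarrow> v \<in> Z \<Longrightarrow> M u v = -1"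
    and "X \<noteq> {}" "Z \<noteq> {}" "even (card Z)"
  shows "card X + card Z \<le> m"
proof (rule ccontr)
  assume contra: "\<not> card X + card Z \<le> m"
  define h where "h \<equiv> signed_degree Z"
  define P where "P = (block x y 1 (-1) - X) \<union> block x y (-1) (-1)"
  define Q where "Q = (block x y (-1) 1 - Z) \<union> block x y 1 1"
  define s t where "s = int (card X)" and "t = int (card Z)"
  note prof = unjoined_sets_profile[OF xy X Z, OF unjoined, folded h_def P_def Q_def s_def t_def]
  have "s \<ge> 1" using \<open>X \<noteq> {}\<close> card_gt_0_iff[of X] by (auto simp: s_def)
  have "t \<ge> 2" using \<open>Z \<noteq> {}\<close> \<open>even (card Z)\<close> card_gt_0_iff[of Z]
    by (auto simp: t_def elim!: evenE)
  have m: "int m \<le> s + t - 1" using contra by (simp add: s_def t_def)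
  have "2 * (s * t) = (\<Sum>u\<in>P. 2 * h u)" by (simp add: prof(1) flip: sum_distrib_left)
  also have "\<dots> \<le> (\<Sum>u\<in>P. h u * h u)"
  proof (rule sum_mono)
    fix u assume "u \<in> P"
    then have "even (h u)"
      using signed_degree_parity(1)[of u Z] prof(5) \<open>even (card Z)\<close> by (auto simp: h_def)
    then obtain k where k: "h u = 2 * k" by blast
    have "k \<le> k * k" by (cases "k \<le> 0") (auto simp: mult_le_cancel_left intro: order_trans)
    then show "2 * h u \<le> h u * h u" by (simp add: k)
  qed
  finally have P: "2 * (s * t) \<le> (\<Sum>u\<in>P. h u * h u)" .
  have "t = (\<Sum>u\<in>Z. 1)" by (simp add: t_def)
  also have "\<dots> \<le> (\<Sum>u\<in>Z. h u * h u)"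
  proof (rule sum_mono)
    fix u assume "u \<in> Z"
    then have "h u \<noteq> 0"
      using signed_degree_parity(2)[of u Z] \<open>even (card Z)\<close> by (auto simp: h_def)
    then show "1 \<le> h u * h u" by (smt (verit) not_real_square_gt_zero mult_eq_0_iff zero_le_square)
  qed
  finally have ZZ: "t \<le> (\<Sum>u\<in>Z. h u * h u)" .
  have "0 \<le> (\<Sum>u\<in>Q. h u * h u)" by (simp add: sum_nonneg)
  with P ZZ prof(2) have "2 * t^2 + s * t^2 + 2 * (s * t) + t \<le> (4 * int m + 1) * t - t^2"
    by linarith
  also have "\<dots> \<le> (4 * (s + t - 1) + 1) * t - t^2"
    using m \<open>t \<ge> 2\<close> by (intro diff_right_mono mult_right_mono) auto
  finally have "t * ((s - 1) * (t - 2) + 2) \<le> 0"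
    by (simp add: algebra_simps power2_eq_square)
  moreover have "(s - 1) * (t - 2) \<ge> 0" using \<open>s \<ge> 1\<close> \<open>t \<ge> 2\<close> by simp
  then have "t * ((s - 1) * (t - 2) + 2) > 0" using \<open>t \<ge> 2\<close> by (intro mult_pos_pos) auto
  ultimately show False by linarith
qed

text \<open>
  For odd \<open>|Z|\<close>, the entries on \<open>P\<close> and \<open>Q\<close> are odd. No odd number lies strictly between 1 and 3,
  so \<open>(h - 1) (h - 3) \<ge> 0\<close>, that is \<open>h\<^sup>2 \<ge> 4 h - 3\<close>; on \<open>P\<close>, where the
  sum of \<open>h\<close> is known, this yields \<open>4 s t - 3 |P|\<close>. On \<open>Q\<close> the bound \<open>h\<^sup>2 \<ge> 1\<close> is enough.
\<close>

lemma unjoined_sets_card_odd: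
  assumes xy: "M x y = 1"
    and X: "X \<subseteq> block x y 1 (-1)" and Z: "Z \<subseteq> block x y (-1) 1"
    and unjoined: "\<And>u v. u \<in> X \<Longrightarrow> v \<in> Z \<Longrightarrow> M u v = -1"
    and "card X \<ge> 2" "card Z \<ge> 2" "odd (card Z)"
  shows "card X + card Z \<le> m"
proof (rule ccontr)
  assume contra: "\<not> card X + card Z \<le> m"
  define h where "h \<equiv> signed_degree Z"
  define P where "P = (block x y 1 (-1) - X) \<union> block x y (-1) (-1)"
  define Q where "Q = (block x y (-1) 1 - Z) \<union> block x y 1 1"
  define s t where "s = int (card X)" and "t = int (card Z)"
  note prof = unjoined_sets_profile[OF xy X Z, OF unjoined, folded h_def P_def Q_def s_def t_def]
  have st: "s \<ge> 2" "t \<ge> 2" using assms by (auto simp: s_def t_def)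
  have m: "int m \<le> s + t - 1" using contra by (simp add: s_def t_def)
  have odd: "odd (h u)" if "u \<in> P \<union> Q" for u
    using signed_degree_parity(1)[of u Z] prof(5,6) \<open>odd (card Z)\<close> that by (auto simp: h_def)
  have "4 * (s * t) - 3 * card P = (\<Sum>u\<in>P. 4 * h u - 3)"
    by (simp add: prof(1) sum_subtractf flip: sum_distrib_left)
  also have "\<dots> \<le> (\<Sum>u\<in>P. h u * h u)"
  proof (rule sum_mono)
    fix u assume "u \<in> P"
    then obtain k where k: "h u = 2 * k + 1" using odd oddE by blast
    have "k \<le> k * k" by (cases "k \<le> 0") (auto simp: mult_le_cancel_left intro: order_trans)
    then show "4 * h u - 3 \<le> h u * h u" by (simp add: k algebra_simps)
  qed
  finally have P: "4 * (s * t) - 3 * (2 * int m - s) \<le> (\<Sum>u\<in>P. h u * h u)"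
    by (simp add: prof(3))
  have "2 * int m - 1 - t = (\<Sum>u\<in>Q. 1)" by (simp add: prof(4))
  also have "\<dots> \<le> (\<Sum>u\<in>Q. h u * h u)"
  proof (rule sum_mono)
    fix u assume "u \<in> Q"
    then have "h u \<noteq> 0" using odd by fastforce
    then show "1 \<le> h u * h u" by (smt (verit) not_real_square_gt_zero mult_eq_0_iff zero_le_square)
  qed
  finally have Q: "2 * int m - 1 - t \<le> (\<Sum>u\<in>Q. h u * h u)" .
  have "0 \<le> (\<Sum>u\<in>Z. h u * h u)" by (simp add: sum_nonneg)
  with P Q prof(2)
  have "2 * t^2 + s * t^2 + 4 * (s * t) + 3 * s - 1 - t \<le> (4 * int m + 1) * t + 4 * int m - t^2"
    by (simp add: algebra_simps)
  also have "\<dots> \<le> (4 * (s + t - 1) + 1) * t + 4 * (s + t - 1) - t^2"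
    using m st by (intro diff_right_mono add_mono mult_right_mono) auto
  finally have "(t - 1) * ((s - 1) * (t + 1) - 2) \<le> 0"
    by (simp add: algebra_simps power2_eq_square)
  moreover have "(s - 1) * (t + 1) \<ge> 1 * 3" using st by (intro mult_mono) auto
  then have "(t - 1) * ((s - 1) * (t + 1) - 2) > 0" using st by (intro mult_pos_pos) auto
  ultimately show False by linarith
qed

text \<open>
  If \<open>w\<close> had no neighbour in the opposite block \<open>B\<close>, the block sums of its row would be forced to the
  extreme values: apart from its zero at \<open>w\<close>, the row is \<open>-1\<close> on \<open>A\<close> and \<open>B\<close> and \<open>1\<close> on
  \<open>C\<close> and \<open>D\<close>. For a point \<open>v\<close> of \<open>D\<close>, the products of its row with the rows at \<open>x\<close>, \<open>y\<close>
  and \<open>w\<close> and with \<open>1\<close> then imply that the row of \<open>v\<close> sums to \<open>0\<close> over \<open>A\<close>. As this is a sum of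
  \<open>m\<close> signs, \<open>m\<close> would be even.
\<close>

lemma joined_to_opposite_block:
  assumes xy: "M x y = 1" and w: "w \<in> block x y 1 (-1)" and "odd m" "m \<ge> 2"
  shows "\<exists>v\<in>block x y (-1) 1. M w v \<noteq> -1"
proof (rule ccontr)
  assume none: "\<not> ?thesis"
  let ?A = "block x y 1 (-1)" and ?B = "block x y (-1) 1"
  let ?C = "block x y (-1) (-1)" and ?D = "block x y 1 1"
  have ne: "x \<noteq> y" using xy diag by force
  have wxy: "M w x = 1" "M w y = -1" "w \<noteq> x" "w \<noteq> y"
    using w xy sym diag by (auto simp: block_def)
  have nw: "w \<notin> ?B" "w \<notin> ?C" "w \<notin> ?D" using w by (auto simp: block_def)
  have B: "sum (M w) ?B = - int m" using none card_blocks[OF xy] by simp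
  have xw: "(\<Sum>u\<in>UNIV. M x u * M w u) = -1" "(\<Sum>u\<in>UNIV. M y u * M w u) = -1"
    using row_inner wxy by metis+
  have sums: "sum (M w) ?C = int m" "sum (M w) ?D = int m - 1" "sum (M w) ?A = 1 - int m"
    using row_products[OF xy, of "M w"] sum_blocks[OF ne, of "M w"] xw wxy B row_sum[of w]
    by simp_all
  have le1: "M w u \<le> 1" "-1 \<le> M w u" for u using off_diag[of w u] diag[of w] by force+
  have C: "M w u = 1" if "u \<in> ?C" for u
  proof -
    have "(\<Sum>u\<in>?C. 1 - M w u) = 0" using sums card_blocks[OF xy] by (simp add: sum_subtractf)
    then show ?thesis using that le1 by (subst (asm) sum_nonneg_eq_0_iff) auto
  qed
  have D: "M w u = 1" if "u \<in> ?D" for u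
  proof -
    have "(\<Sum>u\<in>?D. 1 - M w u) = 0" using sums card_blocks[OF xy] by (simp add: sum_subtractf)
    then show ?thesis using that le1 by (subst (asm) sum_nonneg_eq_0_iff) auto
  qed
  have A: "M w u = -1" if "u \<in> ?A - {w}" for u
  proof -
    have "int (card (?A - {w})) = int m - 1"
      using card_blocks[OF xy] w \<open>m \<ge> 2\<close> by (simp add: of_nat_diff)
    moreover have "sum (M w) (?A - {w}) = 1 - int m" using w sums by (simp add: sum_diff diag)
    ultimately have "(\<Sum>u\<in>?A - {w}. 1 + M w u) = 0" by (simp add: sum.distrib)
    moreover have nonneg: "0 \<le> 1 + M w u" for u using le1(2)[of u] by linarith
    ultimately have "\<forall>u\<in>?A - {w}. 1 + M w u = 0" by (subst (asm) sum_nonneg_eq_0_iff) (simp_all add: nonneg)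
    then show ?thesis using that by force
  qed
  obtain v where v: "v \<in> ?D" using card_blocks(4)[OF xy] \<open>m \<ge> 2\<close> by fastforce
  then have vne: "v \<noteq> w" "v \<noteq> x" "v \<noteq> y" "M v x = 1" "M v y = 1" "M v w = 1"
    using w D[of v] sym diag by (auto simp: block_def)
  have vsums: "(\<Sum>u\<in>UNIV. M x u * M v u) = -1" "(\<Sum>u\<in>UNIV. M y u * M v u) = -1"
      "(\<Sum>u\<in>UNIV. M w u * M v u) = -1"
    using row_inner vne by metis+
  have "(\<Sum>u\<in>?A. M w u * M v u) = 1 - sum (M v) ?A"
  proof -
    have "(\<Sum>u\<in>?A. M w u * M v u) = (\<Sum>u\<in>?A - {w}. M w u * M v u)"
      using w by (subst sum.remove[of _ w]) (simp_all add: diag)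
    also have "\<dots> = - (\<Sum>u\<in>?A - {w}. M v u)"
      using A by (simp add: sum_negf)
    also have "\<dots> = 1 - sum (M v) ?A" using w vne by (simp add: sum_diff)
    finally show ?thesis .
  qed
  moreover have "(\<Sum>u\<in>?B. M w u * M v u) = - sum (M v) ?B"
    using none by (simp add: sum_negf)
  moreover have "(\<Sum>u\<in>?C. M w u * M v u) = sum (M v) ?C" using C by simp
  moreover have "(\<Sum>u\<in>?D. M w u * M v u) = sum (M v) ?D" using D by simp
  ultimately have "sum (M v) ?A = 0"
    using row_products[OF xy, of "M v"] sum_blocks[OF ne, of "M v"] row_sum[of v]
      sum_blocks[OF ne, of "\<lambda>u. M w u * M v u"] vsums vne wxy by simp
  moreover have "even (sum (M v) ?A) \<longleftrightarrow> even (card ?A)"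
  proof (rule sum_signs_parity)
    have "v \<notin> ?A" using v by (auto simp: block_def)
    then show "M v u = 1 \<or> M v u = -1" if "u \<in> ?A" for u using that off_diag by metis
  qed simp
  ultimately show False using card_blocks[OF xy] \<open>odd m\<close> by simp
qed

text \<open>
  Every hypothesis is invariant under exchanging \<open>x\<close> with \<open>y\<close> and \<open>X\<close> with \<open>Z\<close>, so each of the
  preceding lemmas applies in two ways. They leave no case: in a violation both cardinalities are
  odd, one of them is 1, and the other is then \<open>m\<close>.
\<close>

theorem unjoined_sets_card:
  assumes xy: "M x y = 1" and "m \<ge> 2"
    and X: "X \<subseteq> block x y 1 (-1)" and Z: "Z \<subseteq> block x y (-1) 1"
    and unjoined: "\<And>u v. u \<in> X \<Longrightarrow> v \<in> Z \<Longrightarrow> M u v = -1"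
  shows "card X + card Z \<le> m"
proof (rule ccontr)
  assume contra: "\<not> card X + card Z \<le> m"
  have le: "card X \<le> m" "card Z \<le> m"
    using X Z card_mono[of "block x y 1 (-1)" X] card_mono[of "block x y (-1) 1" Z]
      card_blocks[OF xy] by simp_all
  have pos: "card X \<ge> 1" "card Z \<ge> 1" "X \<noteq> {}" "Z \<noteq> {}" using le contra by auto
  have yx: "M y x = 1" using xy sym by simp
  have X': "X \<subseteq> block y x (-1) 1" and Z': "Z \<subseteq> block y x 1 (-1)"
    using X Z by (auto simp: block_swap)
  have unjoined': "\<And>u v. u \<in> Z \<Longrightarrow> v \<in> X \<Longrightarrow> M u v = -1" using unjoined sym by metis
  have odd: "odd (card X)" "odd (card Z)"
    using unjoined_sets_card_even[OF xy X Z unjoined]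
      unjoined_sets_card_even[OF yx Z' X' unjoined'] pos contra by (auto simp: add.commute)
  have "\<not> (card X \<ge> 2 \<and> card Z \<ge> 2)"
    using unjoined_sets_card_odd[OF xy X Z unjoined] odd contra by blast
  then consider "card X = 1" | "card Z = 1" using pos by linarith
  then show False
  proof cases
    case 1
    then have "card Z = m" using le contra by simp
    then have "Z = block x y (-1) 1" using Z card_blocks[OF xy] by (intro card_subset_eq) auto
    moreover obtain w where "w \<in> X" using pos by blast
    ultimately show False
      using joined_to_opposite_block[OF xy, of w] X unjoined odd \<open>card Z = m\<close> \<open>m \<ge> 2\<close> by blast
  next
    case 2
    then have "card X = m" using le contra by simp
    then have "X = block y x (-1) 1" using X' card_blocks[OF yx] by (intro card_subset_eq) auto
    moreover obtain w where "w \<in> Z" using pos by blast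
    ultimately show False
      using joined_to_opposite_block[OF yx, of w] Z' unjoined' odd \<open>card X = m\<close> \<open>m \<ge> 2\<close> by blast
  qed
qed

end

section \<open>The quadratic character of a finite field\<close>

definition quadratic_character :: "'a::field \<Rightarrow> int"
  where "quadratic_character a = (if a = 0 then 0 else if is_square a then 1 else -1)"

text \<open>
  In characteristic 2 the translation by 1 would be a fixed-point-free involution.
\<close>

lemma two_neq_zero_if_odd_card:
  assumes "odd (CARD('a::{field, finite}))"
  shows "(2::'a) \<noteq> 0"
proof
  assume "(2::'a) = 0"
  then have "a + 1 + 1 = a" for a :: 'a by (simp add: add.assoc)
  then have "even (card (UNIV :: 'a set))"
    by (intro even_card_fixpoint_free_involution[where f = "\<lambda>a. a + 1"]) auto
  with assms show False by simp
qed

lemma card_nonzero_squares: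
  assumes "(2::'a::{field, finite}) \<noteq> 0"
  shows "CARD('a) - 1 = 2 * card {a::'a. a \<noteq> 0 \<and> is_square a}"
proof -
  let ?Q = "{a::'a. a \<noteq> 0 \<and> is_square a}"
  have fib: "card {u. u \<in> UNIV - {0} \<and> u^2 = a} = 2" if "a \<in> ?Q" for a
  proof -
    obtain r where r: "a = r^2" using \<open>a \<in> ?Q\<close> by (elim CollectE conjE is_nth_powerE)
    have "r \<noteq> 0" using that r by auto
    have "r \<noteq> - r"
      using assms \<open>r \<noteq> 0\<close> by (metis add_eq_0_iff mult_2 mult_eq_0_iff)
    moreover have "{u. u \<in> UNIV - {0} \<and> u^2 = a} = {r, -r}"
      using \<open>r \<noteq> 0\<close> by (auto simp: r power2_eq_iff)
    ultimately show ?thesis by simp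
  qed
  have "card (UNIV - {0::'a}) = (\<Sum>a\<in>?Q. \<Sum>u | u \<in> UNIV - {0} \<and> u^2 = a. 1)"
    unfolding card_eq_sum by (subst sum.group) auto
  also have "\<dots> = (\<Sum>a\<in>?Q. 2)" using fib by (intro sum.cong) auto
  finally show ?thesis by simp
qed

lemma card_nonsquares:
  assumes "(2::'a::{field, finite}) \<noteq> 0"
  shows "card {a::'a. \<not> is_square a} = card {a::'a. a \<noteq> 0 \<and> is_square a}"
proof -
  let ?Q = "{a::'a. a \<noteq> 0 \<and> is_square a}"
  have "{a::'a. \<not> is_square a} = UNIV - {0} - ?Q" by auto
  moreover have "card (UNIV - {0} - ?Q) = card (UNIV - {0::'a}) - card ?Q"
    by (rule card_Diff_subset) auto
  ultimately have "card {a::'a. \<not> is_square a} = CARD('a) - 1 - card ?Q" by simp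
  then show ?thesis using card_nonzero_squares[OF assms] by linarith
qed

text \<open>
  The squares have index 2 in the multiplicative group: multiplication by a nonsquare maps the nonzero
  squares injectively into the equally many nonsquares, hence onto them.
\<close>

lemma is_square_mult_nonsquares:
  fixes a b :: "'a::{field, finite}"
  assumes two: "(2::'a) \<noteq> 0" and "\<not> is_square a" "\<not> is_square b"
  shows "is_square (a * b)"
proof -
  let ?Q = "{a::'a. a \<noteq> 0 \<and> is_square a}"
  have "a \<noteq> 0" using assms by auto
  have "(*) a ` ?Q \<subseteq> {c. \<not> is_square c}"
  proof clarsimp
    fix c assume "c \<noteq> 0" "is_square c" "is_square (a * c)"
    then obtain r p where "c = r^2" "a * c = p^2" by (auto elim!: is_nth_powerE)
    with \<open>c \<noteq> 0\<close> have "a = (p / r)^2" by (simp add: field_simps power_divide)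
    then show False using \<open>\<not> is_square a\<close> by (auto simp: is_nth_power_def)
  qed
  moreover have "card ((*) a ` ?Q) = card ?Q"
    using \<open>a \<noteq> 0\<close> by (intro card_image) (auto simp: inj_on_def)
  ultimately have "(*) a ` ?Q = {c. \<not> is_square c}"
    using card_nonsquares[OF two] by (intro card_subset_eq) auto
  with \<open>\<not> is_square b\<close> obtain c where "b = a * c" "is_square c" by blast
  then obtain r where "b = a * r^2" by (auto elim!: is_nth_powerE)
  then have "a * b = (a * r)^2" by (simp add: power2_eq_square)
  then show ?thesis by (auto simp: is_nth_power_def)
qed

lemma is_square_mult_cancel:
  fixes a b :: "'a::field"
  assumes "is_square a" "a \<noteq> 0"
  shows "is_square (a * b) \<longleftrightarrow> is_square b"
proof
  assume "is_square (a * b)"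
  then obtain r p where "a = r^2" "a * b = p^2" using assms by (auto elim!: is_nth_powerE)
  with assms have "b = (p / r)^2" by (auto simp: field_simps power_divide)
  then show "is_square b" by (auto simp: is_nth_power_def)
qed (use assms in \<open>auto intro: is_nth_power_mult\<close>)

lemma quadratic_character_mult:
  fixes a b :: "'a::{field, finite}"
  assumes "(2::'a) \<noteq> 0"
  shows "quadratic_character (a * b) = quadratic_character a * quadratic_character b"
  using is_square_mult_nonsquares[OF assms, of a b] is_square_mult_cancel[of a b]
    is_square_mult_cancel[of b a]
  by (auto simp: quadratic_character_def mult.commute)

lemma sum_quadratic_character:
  assumes "(2::'a::{field, finite}) \<noteq> 0"
  shows "(\<Sum>a\<in>(UNIV::'a set). quadratic_character a) = 0"
proof -
  let ?Q = "{a::'a. a \<noteq> 0 \<and> is_square a}" and ?N = "{a::'a. \<not> is_square a}"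
  have U: "(UNIV::'a set) = insert 0 (?Q \<union> ?N)" by auto
  have "(\<Sum>a\<in>(UNIV::'a set). quadratic_character a)
      = (\<Sum>a\<in>?Q. quadratic_character a) + (\<Sum>a\<in>?N. quadratic_character a)"
    by (subst U, subst sum.insert)
      (simp_all add: sum.union_disjoint disjoint_iff, simp add: quadratic_character_def)
  also have "(\<Sum>a\<in>?Q. quadratic_character a) = (\<Sum>a\<in>?Q. 1)"
    by (intro sum.cong) (auto simp: quadratic_character_def)
  also have "(\<Sum>a\<in>?N. quadratic_character a) = (\<Sum>a\<in>?N. -1)"
    by (intro sum.cong) (auto simp: quadratic_character_def)
  finally show ?thesis using card_nonsquares[OF assms] by simp
qed

text \<open>
  Dividing by the nonzero square \<open>u\<^sup>2\<close> gives \<open>\<chi>(u) \<chi>(u + c) = \<chi>(1 + c / u)\<close>, and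
  \<open>1 + c / u\<close> runs through everything except 1 as \<open>u\<close> runs through the nonzero elements.
\<close>

lemma sum_quadratic_character_shift:
  fixes c :: "'a::{field, finite}"
  assumes two: "(2::'a) \<noteq> 0" and "c \<noteq> 0"
  shows "(\<Sum>u\<in>UNIV. quadratic_character u * quadratic_character (u + c)) = -1"
proof -
  let ?q = "quadratic_character :: 'a \<Rightarrow> int"
  have "(\<Sum>u\<in>UNIV. ?q u * ?q (u + c)) = (\<Sum>u\<in>UNIV - {0}. ?q u * ?q (u + c))"
    by (rule sum.mono_neutral_right) (auto simp: quadratic_character_def)
  also have "\<dots> = (\<Sum>u\<in>UNIV - {0}. ?q (1 + c / u))"
  proof (rule sum.cong)
    fix u :: 'a assume "u \<in> UNIV - {0}"
    then have "u + c = u * (1 + c / u)" "?q u * ?q u = 1"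
      by (auto simp: field_simps quadratic_character_def)
    then show "?q u * ?q (u + c) = ?q (1 + c / u)"
      by (simp add: quadratic_character_mult[OF two] flip: mult.assoc)
  qed simp
  also have "\<dots> = (\<Sum>v\<in>UNIV - {1}. ?q v)"
    using \<open>c \<noteq> 0\<close>
    by (intro sum.reindex_bij_witness[of _ "\<lambda>v. c / (v - 1)" "\<lambda>u. 1 + c / u"]) auto
  also have "\<dots> = (\<Sum>v\<in>UNIV. ?q v) - ?q 1" by (simp add: sum_diff)
  finally show ?thesis
    by (simp add: sum_quadratic_character[OF two]) (simp add: quadratic_character_def)
qed

text \<open>
  There is an even number of nonzero squares, and inversion permutes them. It fixes 1, so it has
  another fixed point among them, which can only be \<open>-1\<close>.
\<close>

lemma is_square_minus_one:
  assumes "[CARD('a::{field, finite}) = 1] (mod 4)"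
  shows "is_square (-1 :: 'a)"
proof (rule ccontr)
  assume nsq: "\<not> is_square (-1 :: 'a)"
  have mod: "CARD('a) mod 4 = 1" using assms by (simp add: cong_def)
  then have "odd (CARD('a))" by presburger
  then have two: "(2::'a) \<noteq> 0" by (rule two_neq_zero_if_odd_card)
  let ?Q = "{a::'a. a \<noteq> 0 \<and> is_square a}"
  have "even (card ?Q)" using card_nonzero_squares[OF two] mod by presburger
  moreover have "even (card (?Q - {1}))"
  proof (rule even_card_fixpoint_free_involution[where f = inverse])
    show "inverse a \<in> ?Q - {1}" if "a \<in> ?Q - {1}" for a
      using that by (auto elim!: is_nth_powerE simp flip: power_inverse)
    show "inverse a \<noteq> a" if "a \<in> ?Q - {1}" for a
    proof
      assume "inverse a = a"
      then have "a^2 = 1" using that by (auto simp: power2_eq_square field_simps)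
      then show False using that nsq by (auto simp: power2_eq_1_iff)
    qed
  qed auto
  moreover have "card ?Q = Suc (card (?Q - {1}))" by (rule card.remove) auto
  ultimately show False by (metis even_Suc)
qed

lemma conference_graph_quadratic_character:
  assumes n: "CARD('a::{field, finite}) = 4 * m + 1"
  shows "conference_graph (\<lambda>u v :: 'a. quadratic_character (u - v)) m"
proof
  let ?q = "quadratic_character :: 'a \<Rightarrow> int"
  have "odd (CARD('a))" "[CARD('a) = 1] (mod 4)" by (simp_all add: n cong_def)
  then have two: "(2::'a) \<noteq> 0" and neg: "is_square (-1::'a)"
    using two_neq_zero_if_odd_card is_square_minus_one by blast+
  fix u v :: 'a
  have even: "?q (- a) = ?q a" for a
    using quadratic_character_mult[OF two, of "-1" a] neg by (simp add: quadratic_character_def)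
  from even[of "v - u"] show sym: "?q (u - v) = ?q (v - u)" by simp
  show "?q (u - u) = 0" by (simp add: quadratic_character_def)
  show "?q (u - v) = 1 \<or> ?q (u - v) = -1" if "u \<noteq> v"
    using that by (simp add: quadratic_character_def)
  have "(\<Sum>v\<in>UNIV. ?q (u - v)) = (\<Sum>v\<in>UNIV. ?q v)"
    by (rule sum.reindex_bij_witness[of _ "\<lambda>v. u - v" "\<lambda>v. u - v"]) auto
  then show "(\<Sum>v\<in>UNIV. ?q (u - v)) = 0" by (simp add: sum_quadratic_character[OF two])
  show "(\<Sum>w\<in>UNIV. ?q (u - w) * ?q (v - w)) = -1" if "u \<noteq> v"
  proof -
    have "(\<Sum>w\<in>UNIV. ?q (u - w) * ?q (v - w)) = (\<Sum>w\<in>UNIV. ?q w * ?q (w + (v - u)))"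
      by (rule sum.reindex_bij_witness[of _ "\<lambda>w. u - w" "\<lambda>w. u - w"]) auto
    then show ?thesis using that sum_quadratic_character_shift[OF two, of "v - u"] by simp
  qed
qed (rule n)

section \<open>Paths of length three in the Paley graph\<close>

theorem corollary1p5:
  fixes n :: nat and x y :: "'a :: {field, finite}" and S :: "'a set"
  assumes "n > 5" and "primepow n" and "[n = 1] (mod 4)"
    and "CARD('a) = n"
    and "x - y \<noteq> 0" and "is_square (x - y)"
    and "S \<subseteq> UNIV - {x, y}"
    and "real (card S) \<ge> 3 / 4 * (real n - 1)"
  shows "\<exists>w\<in>S. \<exists>z\<in>S.
           x - w \<noteq> 0 \<and> is_square (x - w) \<and>
           w - z \<noteq> 0 \<and> is_square (w - z) \<and>
           z - y \<noteq> 0 \<and> is_square (z - y) \<and>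
           \<not> is_square (x - z) \<and> \<not> is_square (y - w)"
proof (rule ccontr)
  assume none: "\<not> ?thesis"
  define m where "m = n div 4"
  have "n mod 4 = 1" using assms(3) by (simp add: cong_def)
  then have n: "n = 4 * m + 1" unfolding m_def by presburger
  let ?M = "\<lambda>u v :: 'a. quadratic_character (u - v)"
  interpret conference_graph ?M m
    using n assms(4) by (intro conference_graph_quadratic_character) simp
  have xy: "?M x y = 1" using assms by (simp add: quadratic_character_def)
  let ?A = "block x y 1 (-1)" and ?B = "block x y (-1) 1"
  have char_1: "quadratic_character a = 1 \<longleftrightarrow> a \<noteq> 0 \<and> is_square a"
    and char_m1: "quadratic_character a = -1 \<longleftrightarrow> \<not> is_square a" for a :: 'a
    by (auto simp: quadratic_character_def)
  have "card (?A \<inter> S) + card (?B \<inter> S) \<le> m"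
  proof (rule unjoined_sets_card[OF xy])
    fix w z assume wz: "w \<in> ?A \<inter> S" "z \<in> ?B \<inter> S"
    then have "w \<noteq> z" by (auto simp: block_def)
    have "?M w z \<noteq> 1"
    proof
      assume "?M w z = 1"
      moreover have "?M z y = 1" using wz sym[of y z] by (simp add: block_def)
      ultimately show False using wz none unfolding block_def char_1 char_m1 by blast
    qed
    then show "?M w z = -1" using off_diag[OF \<open>w \<noteq> z\<close>] by blast
  qed (use n assms(1) in auto)
  moreover have "card ((?A \<union> ?B) - S) + card S \<le> 4 * m - 1"
  proof -
    have "card ((?A \<union> ?B) - S) + card S = card (((?A \<union> ?B) - S) \<union> S)"
      by (rule card_Un_disjoint[symmetric]) auto
    also have "\<dots> \<le> card (UNIV - {x, y})"
      using assms(7) xy sym[of y x] diag[of x] by (intro card_mono) (auto simp: block_def)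
    also have "\<dots> = 4 * m - 1"
      using assms(4,5) n by (simp add: card_Diff_subset)
    finally show ?thesis .
  qed
  moreover have "card ((?A \<union> ?B) - S) + (card (?A \<inter> S) + card (?B \<inter> S)) = 2 * m"
  proof -
    have disj: "?A \<inter> ?B = {}" by (auto simp: block_def)
    have "card (?A \<inter> S) + card (?B \<inter> S) = card ((?A \<union> ?B) \<inter> S)"
      using disj by (subst card_Un_disjoint[symmetric]) (auto simp: Int_Un_distrib2)
    moreover have "card (?A \<union> ?B) = 2 * m"
      using disj card_blocks[OF xy] by (subst card_Un_disjoint) auto
    moreover have "card ((?A \<union> ?B) - S) + card ((?A \<union> ?B) \<inter> S) = card (?A \<union> ?B)"
      by (subst card_Un_disjoint[symmetric]) (auto intro!: arg_cong[of _ _ card])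
    ultimately show ?thesis by simp
  qed
  moreover have "card S \<ge> 3 * m" using assms(8) n by simp
  ultimately show False using n assms(1) by linarith
qed

end
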